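(* Let $\mathcal H_1,\mathcal H_2,\mathcal G$ be real Hilbert spaces, $A:\mathcal H_1\to\mathcal G$ and $B:\mathcal H_2\to\mathcal G$ continuous linear maps, $b\in\mathcal G$, $\lambda>0$, and $f$, $g$ proper closed convex extended-real-valued functions on $\mathcal H_1$, $\mathcal H_2$; let $F,G$ and Algorithms 1 and 5 be as in the context, under the standing assumptions stated there. 1. Assume that $\operatorname{prox}_{\lambda G}$ is affine. Let $y_5^k,z_5^k,x_5^k$ be the sequences of Algorithm 5, and suppose $-z_5^0\in\partial G(By_5^0-b)$. Then one can initialize Algorithm 1 with $x_1^0=x_5^1$ and $z_1^0=z_5^0+\lambda^{-1}(Ax_5^1+By_5^0-b)$ and recover its sequences $x_1^k,z_1^k$ through: for all $k\ge0$, $$x_1^k=x_5^{k+1},\qquad z_1^k=z_5^k+\lambda^{-1}(Ax_5^{k+1}+By_5^k-b).$$ 2. Assume that $\operatorname{prox}_{\lambda F}$ is affine. Let $x_1^k,z_1^k,y_1^k$ be the sequences of Algorithm 1, and suppose $-z_1^0\in\partial F(Ax_1^0)$. Then one can initialize Algorithm 5 with $y_5^0=y_1^1$ and $z_5^0=z_1^0+\lambda^{-1}(Ax_1^0+By_1^1-b)$ and recover its sequences $y_5^k,z_5^k$ through: for all $k\ge0$, $$y_5^k=y_1^{k+1},\qquad z_5^k=z_1^k+\lambda^{-1}(Ax_1^k+By_1^{k+1}-b).$$ Here "recover" means that the sequences defined by these formulas are, for suitable choices of minimizers in the subproblems, the corresponding sequences of a run of the target algorithm with the stated initialization.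
   Context: $\operatorname{prox}_h(x)=\arg\min_y h(y)+\frac12\|y-x\|^2$; $\partial$ is the convex subdifferential. A mapping $T$ is called affine if $T(\frac12r_1+\frac12r_2)=\frac12Tr_1+\frac12Tr_2$ for all $r_1,r_2$. Define on $\mathcal G$ $$F(s)=\min_x\{f(x):Ax=s\},\qquad G(t)=\min_y\{g(y):By-b=t\}$$ (value $+\infty$ if infeasible). Standing assumptions: all functions, including $F$ and $G$, are proper, closed and convex; the minima defining $F,G$ are attained wherever finite (so all subproblems below have solutions); saddle-point solutions exist. Algorithm 1 (ADM on: minimize $f(x)+g(y)$ subject to $Ax+By=b$): given $x_1^0,z_1^0$, for $k=0,1,\dots$: $y_1^{k+1}\in\arg\min_y g(y)+\frac1{2\lambda}\|Ax_1^k+By-b+\lambda z_1^k\|^2$; $x_1^{k+1}\in\arg\min_x f(x)+\frac1{2\lambda}\|Ax+By_1^{k+1}-b+\lambda z_1^k\|^2$; $z_1^{k+1}=z_1^k+\lambda^{-1}(Ax_1^{k+1}+By_1^{k+1}-b)$. Algorithm 5 (ADM with the opposite update order): given $y_5^0,z_5^0$, for $k=0,1,\dots$: $x_5^{k+1}\in\arg\min_x f(x)+\frac1{2\lambda}\|Ax+By_5^k-b+\lambda z_5^k\|^2$; $y_5^{k+1}\in\arg\min_y g(y)+\frac1{2\lambda}\|Ax_5^{k+1}+By-b+\lambda z_5^k\|^2$; $z_5^{k+1}=z_5^k+\lambda^{-1}(Ax_5^{k+1}+By_5^{k+1}-b)$. *)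

theory Defs
  imports "HOL-Analysis.Analysis"
begin

text \<open>
  Extended-real-valued functions are functions into \<^typ>\<open>ereal\<close>. The library's
  \<^const>\<open>epigraph\<close> only covers real-valued functions.
\<close>

definition ereal_epigraph :: "('a \<Rightarrow> ereal) \<Rightarrow> ('a \<times> real) set" where
  "ereal_epigraph h = {(x, r). h x \<le> ereal r}"

definition proper_fun :: "('a \<Rightarrow> ereal) \<Rightarrow> bool" where
  "proper_fun h \<longleftrightarrow> (\<forall>x. h x \<noteq> -\<infinity>) \<and> (\<exists>x. h x \<noteq> \<infinity>)"

definition proper_closed_convex :: "('a::real_normed_vector \<Rightarrow> ereal) \<Rightarrow> bool" where
  "proper_closed_convex h \<longleftrightarrow>
     proper_fun h \<and> closed (ereal_epigraph h) \<and> convex (ereal_epigraph h)"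

text \<open>For proper \<open>h\<close> the set below is empty wherever \<open>h x = \<infinity>\<close>.\<close>

definition subdifferential :: "('a::real_inner \<Rightarrow> ereal) \<Rightarrow> 'a \<Rightarrow> 'a set" where
  "subdifferential h x = {u. \<forall>y. h x + ereal (inner u (y - x)) \<le> h y}"

text \<open>
  For a proper closed convex function on a Hilbert space the minimizer exists and is unique,
  so the choice made by \<^const>\<open>arg_min\<close> is immaterial.
\<close>

definition prox :: "('a::real_inner \<Rightarrow> ereal) \<Rightarrow> 'a \<Rightarrow> 'a" where
  "prox h x = arg_min (\<lambda>y. h y + ereal (1 / 2 * (norm (y - x))\<^sup>2)) (\<lambda>_. True)"

definition affine_mapping :: "('a::real_vector \<Rightarrow> 'b::real_vector) \<Rightarrow> bool" where
  "affine_mapping T \<longleftrightarrow>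
     (\<forall>r\<^sub>1 r\<^sub>2. T ((1 / 2) *\<^sub>R r\<^sub>1 + (1 / 2) *\<^sub>R r\<^sub>2)
              = (1 / 2) *\<^sub>R T r\<^sub>1 + (1 / 2) *\<^sub>R T r\<^sub>2)"

text \<open>
  The function \<open>t \<mapsto> min {h x | M x = t}\<close>. As an infimum in \<^typ>\<open>ereal\<close> it is \<open>\<infinity>\<close> where the
  constraint is infeasible; that the infimum is a minimum is the separate predicate
  \<open>min_attained\<close>.
\<close>

definition min_over_fibre :: "('a \<Rightarrow> 'c) \<Rightarrow> ('a \<Rightarrow> ereal) \<Rightarrow> 'c \<Rightarrow> ereal" where
  "min_over_fibre M h t = (INF x\<in>{x. M x = t}. h x)"

definition min_attained :: "('a \<Rightarrow> 'c) \<Rightarrow> ('a \<Rightarrow> ereal) \<Rightarrow> bool" where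
  "min_attained M h \<longleftrightarrow>
     (\<forall>t. \<bar>min_over_fibre M h t\<bar> \<noteq> \<infinity> \<longrightarrow> (\<exists>x. M x = t \<and> h x = min_over_fibre M h t))"

definition lagrangian ::
  "('a \<Rightarrow> ereal) \<Rightarrow> ('b \<Rightarrow> ereal) \<Rightarrow> ('a \<Rightarrow> 'c) \<Rightarrow> ('b \<Rightarrow> 'c) \<Rightarrow> 'c::real_inner
    \<Rightarrow> 'a \<Rightarrow> 'b \<Rightarrow> 'c \<Rightarrow> ereal" where
  "lagrangian f g A B b x y z = f x + g y + ereal (inner z (A x + B y - b))"

definition saddle_point ::
  "('a \<Rightarrow> ereal) \<Rightarrow> ('b \<Rightarrow> ereal) \<Rightarrow> ('a \<Rightarrow> 'c) \<Rightarrow> ('b \<Rightarrow> 'c) \<Rightarrow> 'c::real_inner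
    \<Rightarrow> 'a \<Rightarrow> 'b \<Rightarrow> 'c \<Rightarrow> bool" where
  "saddle_point f g A B b x\<^sub>0 y\<^sub>0 z\<^sub>0 \<longleftrightarrow>
     (\<forall>z. lagrangian f g A B b x\<^sub>0 y\<^sub>0 z \<le> lagrangian f g A B b x\<^sub>0 y\<^sub>0 z\<^sub>0) \<and>
     (\<forall>x y. lagrangian f g A B b x\<^sub>0 y\<^sub>0 z\<^sub>0 \<le> lagrangian f g A B b x y z\<^sub>0)"

text \<open>
  The two update orders of the alternating direction method, as predicates on triples of
  sequences since the minimizers need not be unique. The initial values of a run are
  \<open>x 0, z 0\<close> for \<open>adm_y_first\<close>, where \<open>y 0\<close> is unused, and \<open>y 0, z 0\<close> for \<open>adm_x_first\<close>,
  where \<open>x 0\<close> is unused.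
\<close>

definition adm_y_first ::
  "('a \<Rightarrow> ereal) \<Rightarrow> ('b \<Rightarrow> ereal) \<Rightarrow> ('a \<Rightarrow> 'c) \<Rightarrow> ('b \<Rightarrow> 'c) \<Rightarrow> 'c::real_inner \<Rightarrow> real
    \<Rightarrow> (nat \<Rightarrow> 'a) \<Rightarrow> (nat \<Rightarrow> 'b) \<Rightarrow> (nat \<Rightarrow> 'c) \<Rightarrow> bool" where
  "adm_y_first f g A B b lam x y z \<longleftrightarrow>
     (\<forall>k.
       is_arg_min
         (\<lambda>v. g v + ereal (1 / (2 * lam) * (norm (A (x k) + B v - b + lam *\<^sub>R z k))\<^sup>2))
         (\<lambda>_. True) (y (k + 1)) \<and>
       is_arg_min
         (\<lambda>u. f u + ereal (1 / (2 * lam) * (norm (A u + B (y (k + 1)) - b + lam *\<^sub>R z k))\<^sup>2))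
         (\<lambda>_. True) (x (k + 1)) \<and>
       z (k + 1) = z k + inverse lam *\<^sub>R (A (x (k + 1)) + B (y (k + 1)) - b))"

definition adm_x_first ::
  "('a \<Rightarrow> ereal) \<Rightarrow> ('b \<Rightarrow> ereal) \<Rightarrow> ('a \<Rightarrow> 'c) \<Rightarrow> ('b \<Rightarrow> 'c) \<Rightarrow> 'c::real_inner \<Rightarrow> real
    \<Rightarrow> (nat \<Rightarrow> 'a) \<Rightarrow> (nat \<Rightarrow> 'b) \<Rightarrow> (nat \<Rightarrow> 'c) \<Rightarrow> bool" where
  "adm_x_first f g A B b lam x y z \<longleftrightarrow>
     (\<forall>k.
       is_arg_min
         (\<lambda>u. f u + ereal (1 / (2 * lam) * (norm (A u + B (y k) - b + lam *\<^sub>R z k))\<^sup>2))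
         (\<lambda>_. True) (x (k + 1)) \<and>
       is_arg_min
         (\<lambda>v. g v + ereal (1 / (2 * lam) * (norm (A (x (k + 1)) + B v - b + lam *\<^sub>R z k))\<^sup>2))
         (\<lambda>_. True) (y (k + 1)) \<and>
       z (k + 1) = z k + inverse lam *\<^sub>R (A (x (k + 1)) + B (y (k + 1)) - b))"

end

theory Submission
  imports Defs
begin

text \<open>
  In the first claim write \<open>s\<^sub>k = A x\<^sub>k\<close> and \<open>t\<^sub>k = B y\<^sub>k - b\<close>, so that the constraint reads \<open>s + t = 0\<close>, and let \<open>T\<close> be the proximal map of \<open>\<lambda>G\<close>. The second update says
  \<open>t\<^sub>k\<^sub>+\<^sub>1 = T r\<^sub>k\<^sub>+\<^sub>1\<close> with \<open>r\<^sub>k\<^sub>+\<^sub>1 = - s\<^sub>k\<^sub>+\<^sub>1 - \<lambda> z\<^sub>k\<close>, and the multiplier update turns this into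
  \<open>r\<^sub>k\<^sub>+\<^sub>1 = t\<^sub>k\<^sub>+\<^sub>1 - \<lambda> z\<^sub>k\<^sub>+\<^sub>1\<close>; the subgradient condition on the initial values is \<open>t\<^sub>0 = T (t\<^sub>0 - \<lambda> z\<^sub>0)\<close>.
  The run with the opposite order needs \<open>T (2 r\<^sub>k\<^sub>+\<^sub>1 - r\<^sub>k)\<close>, which for affine \<open>T\<close> equals
  \<open>2 t\<^sub>k\<^sub>+\<^sub>1 - t\<^sub>k\<close>; the remaining updates then agree by direct computation. Linearity of the
  constraint maps plays no role, so the two claims are the same after exchanging the blocks.
\<close>

section \<open>Closed convex functions plus a quadratic: unique minimizers and their
  existence\<close>

lemma norm_midpoint_sq:
  fixes a d w :: "'a::real_inner"
  shows "(norm ((1 / 2) *\<^sub>R a + (1 / 2) *\<^sub>R d + w))\<^sup>2 =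
    (norm (a + w))\<^sup>2 / 2 + (norm (d + w))\<^sup>2 / 2 - (norm (a - d))\<^sup>2 / 4"
  unfolding power2_norm_eq_inner
  by (simp add: inner_left_distrib inner_right_distrib inner_diff_left inner_diff_right
      inner_commute field_simps)

lemma proper_closed_convex_midpoint:
  assumes "proper_closed_convex h" "h a \<le> ereal \<alpha>" "h d \<le> ereal \<delta>"
  shows "h ((1 / 2) *\<^sub>R a + (1 / 2) *\<^sub>R d) \<le> ereal (\<alpha> / 2 + \<delta> / 2)"
proof -
  have "convex (ereal_epigraph h)" "(a, \<alpha>) \<in> ereal_epigraph h" "(d, \<delta>) \<in> ereal_epigraph h"
    using assms by (auto simp: proper_closed_convex_def ereal_epigraph_def)
  from convexD[OF this, of "1 / 2" "1 / 2"] show ?thesis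
    by (simp add: ereal_epigraph_def)
qed

lemma is_arg_min_True_iff:
  fixes f :: "'a \<Rightarrow> 'b::linorder"
  shows "is_arg_min f (\<lambda>_. True) x \<longleftrightarrow> (\<forall>y. f x \<le> f y)"
  by (auto simp: is_arg_min_linorder)

lemma finite_at_arg_min:
  fixes h :: "'a \<Rightarrow> ereal"
  assumes "proper_fun h" "is_arg_min (\<lambda>t. h t + ereal (q t)) (\<lambda>_. True) t"
  shows "\<bar>h t\<bar> \<noteq> \<infinity>"
proof -
  obtain a where "h a \<noteq> \<infinity>" and ninf: "\<And>x. h x \<noteq> -\<infinity>"
    using assms(1) by (auto simp: proper_fun_def)
  moreover have "h t + ereal (q t) \<le> h a + ereal (q a)"
    using assms(2) by (simp add: is_arg_min_True_iff)
  ultimately have "h t \<noteq> \<infinity>"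
    by (cases "h a") auto
  then show ?thesis using ninf[of t] by auto
qed

text \<open>Both minimizers are compared with their midpoint. Adding the two inequalities cancels
  everything except the defect term of the parallelogram law, so
  \<open>c * (norm (t - s))\<^sup>2\<close> cannot be positive.\<close>

lemma quadratic_arg_min_unique:
  fixes h :: "'c::real_inner \<Rightarrow> ereal"
  assumes h: "proper_closed_convex h" and c: "c > 0"
    and t: "is_arg_min (\<lambda>t. h t + ereal (c * (norm (t + w))\<^sup>2)) (\<lambda>_. True) t"
    and s: "is_arg_min (\<lambda>t. h t + ereal (c * (norm (t + w))\<^sup>2)) (\<lambda>_. True) s"
  shows "t = s"
proof -
  have "proper_fun h" using h by (simp add: proper_closed_convex_def)
  then obtain \<alpha> \<beta> where ab: "h t = ereal \<alpha>" "h s = ereal \<beta>"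
    using finite_at_arg_min[OF _ t] finite_at_arg_min[OF _ s]
    by (cases "h t"; cases "h s"; auto)
  define m where "m = (1 / 2) *\<^sub>R t + (1 / 2) *\<^sub>R s"
  have m: "h m \<le> ereal (\<alpha> / 2 + \<beta> / 2)"
    unfolding m_def using proper_closed_convex_midpoint[OF h] ab by simp
  have "h t + ereal (c * (norm (t + w))\<^sup>2) \<le> h m + ereal (c * (norm (m + w))\<^sup>2)"
    "h s + ereal (c * (norm (s + w))\<^sup>2) \<le> h m + ereal (c * (norm (m + w))\<^sup>2)"
    using t s by (auto simp: is_arg_min_True_iff)
  with m have 1: "\<alpha> + c * (norm (t + w))\<^sup>2 \<le> \<alpha> / 2 + \<beta> / 2 + c * (norm (m + w))\<^sup>2"
    and 2: "\<beta> + c * (norm (s + w))\<^sup>2 \<le> \<alpha> / 2 + \<beta> / 2 + c * (norm (m + w))\<^sup>2"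
    using ab by (cases "h m"; force)+
  have "c * (norm (m + w))\<^sup>2
      = c * (norm (t + w))\<^sup>2 / 2 + c * (norm (s + w))\<^sup>2 / 2 - c * (norm (t - s))\<^sup>2 / 4"
    unfolding m_def norm_midpoint_sq by (simp add: algebra_simps)
  with 1 2 have "c * (norm (t - s))\<^sup>2 \<le> 0" by linarith
  with c show ?thesis by (simp add: mult_le_0_iff)
qed

text \<open>The subgradient supplies an affine minorant, and Cauchy-Schwarz with Young's inequality
  absorbs its linear part into the quadratic. Quantifying over real heights \<open>e\<close> keeps
  the infimum in the existence proof below a real one.\<close>

lemma subdifferential_quadratic_lower_bound:
  fixes h :: "'c::real_inner \<Rightarrow> ereal"
  assumes h: "proper_fun h" and u: "u \<in> subdifferential h t0" and c: "c > 0"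
  shows "\<exists>L. \<forall>t e. h t \<le> ereal e \<longrightarrow> L \<le> e + c * (norm (t + w))\<^sup>2"
proof -
  have sub: "h t0 + ereal (inner u (y - t0)) \<le> h y" for y
    using u by (simp add: subdifferential_def)
  obtain a where "h a \<noteq> \<infinity>" using h by (auto simp: proper_fun_def)
  then have "h t0 \<noteq> \<infinity>" "h t0 \<noteq> -\<infinity>"
    using sub[of a] h by (cases "h a"; auto simp: proper_fun_def)+
  then obtain \<tau> where \<tau>: "h t0 = ereal \<tau>" by (cases "h t0") auto
  have "\<tau> - inner u (w + t0) - (norm u)\<^sup>2 / (4 * c) \<le> e + c * (norm (t + w))\<^sup>2"
    if "h t \<le> ereal e" for t e
  proof -
    have "\<tau> + inner u (t - t0) \<le> e"
      using order_trans[OF sub[of t] that] \<tau> by simp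
    moreover have "inner u (t - t0) = inner u (t + w) - inner u (w + t0)"
      by (simp add: inner_right_distrib inner_diff_right)
    moreover have "- (norm u * norm (t + w)) \<le> inner u (t + w)"
      using Cauchy_Schwarz_ineq2[of u "t + w"] by linarith
    moreover have "norm u * norm (t + w) \<le> (norm u)\<^sup>2 / (4 * c) + c * (norm (t + w))\<^sup>2"
    proof -
      \<comment> \<open>Young's inequality with weight \<open>c\<close>, by completing the
        square.\<close>
      have "0 \<le> (norm u - 2 * c * norm (t + w))\<^sup>2 / (4 * c)" using c by simp
      also have "\<dots> = (norm u)\<^sup>2 / (4 * c) + c * (norm (t + w))\<^sup>2 - norm u * norm (t + w)"
        using c by (simp add: field_simps power2_eq_square)
      finally show ?thesis by simp
    qed
    ultimately show ?thesis by linarith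
  qed
  then show ?thesis by blast
qed

text \<open>Direct method without weak compactness: by the parallelogram law a minimizing sequence
  is Cauchy, and closedness of the epigraph passes to the limit. The subgradient bounds the
  objective from below.\<close>

lemma quadratic_arg_min_exists:
  fixes h :: "'c::{real_inner, complete_space} \<Rightarrow> ereal"
  assumes h: "proper_closed_convex h" and c: "c > 0" and u: "u \<in> subdifferential h t0"
  shows "\<exists>t. is_arg_min (\<lambda>t. h t + ereal (c * (norm (t + w))\<^sup>2)) (\<lambda>_. True) t"
proof -
  have proper: "proper_fun h" and clo: "closed (ereal_epigraph h)"
    using h by (auto simp: proper_closed_convex_def)
  define \<epsilon> :: "nat \<Rightarrow> real" where "\<epsilon> n = inverse (real (Suc n))" for n
  have \<epsilon>_pos: "\<epsilon> n > 0" for n by (simp add: \<epsilon>_def)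
  define q where "q = (\<lambda>t. c * (norm (t + w))\<^sup>2)"
  define S where "S = {e + q t | t e. h t \<le> ereal e}"
  obtain L where "\<And>t e. h t \<le> ereal e \<Longrightarrow> L \<le> e + q t"
    using subdifferential_quadratic_lower_bound[OF proper u c, of w] unfolding q_def by blast
  then have bdd: "bdd_below S"
    unfolding S_def by (intro bdd_belowI[of _ L]) auto
  obtain a where "h a \<noteq> \<infinity>" "h a \<noteq> -\<infinity>" using proper by (auto simp: proper_fun_def)
  then have "S \<noteq> {}" unfolding S_def by (cases "h a") (auto intro!: exI[of _ a])
  define m where "m = Inf S"
  have m_le: "m \<le> e + q t" if "h t \<le> ereal e" for t e
    unfolding m_def using that bdd by (intro cInf_lower) (auto simp: S_def)
  have "\<exists>t e. h t \<le> ereal e \<and> e + q t < m + \<epsilon> n" for n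
    using cInf_lessD[OF \<open>S \<noteq> {}\<close>, of "m + \<epsilon> n"] \<epsilon>_pos[of n]
    unfolding m_def[symmetric] by (auto simp: S_def)
  then obtain t e where te: "\<And>n. h (t n) \<le> ereal (e n)"
      and lt: "\<And>n. e n + q (t n) < m + \<epsilon> n"
    by metis
  have close: "c * (norm (t i - t j))\<^sup>2 \<le> 2 * \<epsilon> i + 2 * \<epsilon> j" for i j
  proof -
    have "m \<le> (e i / 2 + e j / 2) + q ((1 / 2) *\<^sub>R t i + (1 / 2) *\<^sub>R t j)"
      by (intro m_le proper_closed_convex_midpoint[OF h] te)
    moreover have "q ((1 / 2) *\<^sub>R t i + (1 / 2) *\<^sub>R t j)
        = q (t i) / 2 + q (t j) / 2 - c * (norm (t i - t j))\<^sup>2 / 4"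
      unfolding q_def norm_midpoint_sq by (simp add: algebra_simps)
    ultimately show ?thesis using lt[of i] lt[of j] by linarith
  qed
  have "Cauchy t"
  proof (rule metric_CauchyI)
    fix d :: real assume "d > 0"
    then have "c * d\<^sup>2 / 4 > 0" using c by simp
    then obtain N where N: "\<epsilon> N < c * d\<^sup>2 / 4"
      using reals_Archimedean unfolding \<epsilon>_def by blast
    have "dist (t i) (t j) < d" if "i \<ge> N" "j \<ge> N" for i j
    proof -
      have "\<epsilon> i \<le> \<epsilon> N" "\<epsilon> j \<le> \<epsilon> N"
        using that by (auto simp: \<epsilon>_def intro!: le_imp_inverse_le)
      with close[of i j] N have "c * (norm (t i - t j))\<^sup>2 < c * d\<^sup>2" by linarith
      then have "(norm (t i - t j))\<^sup>2 < d\<^sup>2" using c by simp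
      then show ?thesis using \<open>d > 0\<close> unfolding dist_norm by (simp add: power2_less_imp_less)
    qed
    then show "\<exists>N. \<forall>i\<ge>N. \<forall>j\<ge>N. dist (t i) (t j) < d" by blast
  qed
  then obtain l where l: "t \<longlonglongrightarrow> l"
    using Cauchy_convergent convergent_def by blast
  have q: "(\<lambda>n. q (t n)) \<longlonglongrightarrow> q l" unfolding q_def by (intro tendsto_intros l)
  have "(\<lambda>n. e n + q (t n)) \<longlonglongrightarrow> m"
  proof (rule tendsto_sandwich[where f = "\<lambda>_. m" and h = "\<lambda>n. m + \<epsilon> n"])
    show "(\<lambda>n. m + \<epsilon> n) \<longlonglongrightarrow> m"
      using tendsto_add[OF tendsto_const LIMSEQ_inverse_real_of_nat, of m] by (simp add: \<epsilon>_def)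
  qed (use m_le[OF te] lt in \<open>auto intro!: always_eventually less_imp_le\<close>)
  \<comment> \<open>The heights converge because both the objective values and the quadratic part
    do; hence the pairs have a limit in the epigraph.\<close>
  from tendsto_diff[OF this q] have "e \<longlonglongrightarrow> m - q l" by simp
  with l have "(\<lambda>n. (t n, e n)) \<longlonglongrightarrow> (l, m - q l)" by (rule tendsto_Pair)
  moreover have "\<forall>n. (t n, e n) \<in> ereal_epigraph h" using te by (simp add: ereal_epigraph_def)
  ultimately have "(l, m - q l) \<in> ereal_epigraph h"
    using closed_sequentially[OF clo, of "\<lambda>n. (t n, e n)"] by simp
  then have l_le: "h l \<le> ereal (m - q l)" by (simp add: ereal_epigraph_def)
  have "h l + ereal (q l) \<le> h y + ereal (q y)" for y
  proof -
    have "h l + ereal (q l) \<le> ereal m"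
      using add_right_mono[OF l_le, of "ereal (q l)"] by simp
    also have "ereal m \<le> h y + ereal (q y)"
      using m_le[of y] proper by (cases "h y") (auto simp: proper_fun_def)
    finally show ?thesis .
  qed
  then show ?thesis unfolding is_arg_min_True_iff q_def by blast
qed

section \<open>Proximal maps and subgradients\<close>

lemma prox_eqI:
  fixes h :: "'c::real_inner \<Rightarrow> ereal"
  assumes h: "proper_closed_convex h" and lam: "lam > 0"
    and t: "is_arg_min (\<lambda>t. h t + ereal (1 / (2 * lam) * (norm (t + w))\<^sup>2)) (\<lambda>_. True) t"
  shows "prox (\<lambda>t. ereal lam * h t) (- w) = t"
proof -
  let ?\<phi> = "\<lambda>t. h t + ereal (1 / (2 * lam) * (norm (t + w))\<^sup>2)"
  let ?\<psi> = "\<lambda>y. ereal lam * h y + ereal (1 / 2 * (norm (y - - w))\<^sup>2)"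
  \<comment> \<open>The positive factor \<open>lam\<close> preserves minimizers; uniqueness then
    pins down the choice made by \<open>arg_min\<close>.\<close>
  have scale: "?\<psi> y = ereal lam * ?\<phi> y" for y
    using lam by (cases "h y") (auto simp: field_simps)
  have "is_arg_min ?\<psi> (\<lambda>_. True) s \<longleftrightarrow> is_arg_min ?\<phi> (\<lambda>_. True) s" for s
    unfolding is_arg_min_True_iff scale
    using lam by (simp add: ereal_mult_le_mult_iff)
  then show ?thesis
    unfolding prox_def arg_min_def
    using quadratic_arg_min_unique[OF h, of "1 / (2 * lam)" w] lam t
    by (intro some_equality) auto
qed

text \<open>The offset is chosen so that the square at \<open>t\<close> is that of
  \<open>lam *\<^sub>R u\<close>. Expanding around \<open>t\<close> leaves the linear term
  \<open>inner u (s - t)\<close>, which cancels the one in the subgradient inequality.\<close>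

lemma subdifferential_imp_arg_min:
  fixes h :: "'c::real_inner \<Rightarrow> ereal"
  assumes u: "- u \<in> subdifferential h t" and lam: "lam > 0"
  shows "is_arg_min (\<lambda>s. h s + ereal (1 / (2 * lam) * (norm (s + (lam *\<^sub>R u - t)))\<^sup>2)) (\<lambda>_. True) t"
  unfolding is_arg_min_True_iff
proof
  fix s
  have "(norm (s + (lam *\<^sub>R u - t)))\<^sup>2
      = (norm (s - t))\<^sup>2 + 2 * lam * inner u (s - t) + (norm (t + (lam *\<^sub>R u - t)))\<^sup>2"
    unfolding power2_norm_eq_inner
    by (simp add: inner_left_distrib inner_right_distrib inner_diff_left inner_diff_right
        inner_commute algebra_simps)
  then have "1 / (2 * lam) * (norm (s + (lam *\<^sub>R u - t)))\<^sup>2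
      = 1 / (2 * lam) * (norm (s - t))\<^sup>2 + inner u (s - t)
        + 1 / (2 * lam) * (norm (t + (lam *\<^sub>R u - t)))\<^sup>2"
    using lam by (simp add: field_simps)
  moreover have "0 \<le> 1 / (2 * lam) * (norm (s - t))\<^sup>2" using lam by simp
  ultimately have "1 / (2 * lam) * (norm (t + (lam *\<^sub>R u - t)))\<^sup>2
      \<le> inner (- u) (s - t) + 1 / (2 * lam) * (norm (s + (lam *\<^sub>R u - t)))\<^sup>2"
    by simp
  then have "h t + ereal (1 / (2 * lam) * (norm (t + (lam *\<^sub>R u - t)))\<^sup>2)
      \<le> h t + ereal (inner (- u) (s - t)) + ereal (1 / (2 * lam) * (norm (s + (lam *\<^sub>R u - t)))\<^sup>2)"
    unfolding add.assoc plus_ereal.simps by (intro add_left_mono) simp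
  also have "\<dots> \<le> h s + ereal (1 / (2 * lam) * (norm (s + (lam *\<^sub>R u - t)))\<^sup>2)"
    using u by (intro add_right_mono) (simp add: subdifferential_def)
  finally show "h t + ereal (1 / (2 * lam) * (norm (t + (lam *\<^sub>R u - t)))\<^sup>2)
      \<le> h s + ereal (1 / (2 * lam) * (norm (s + (lam *\<^sub>R u - t)))\<^sup>2)" .
qed

section \<open>Passing between subproblems and their images in the constraint space\<close>

lemma min_over_fibre_le: "min_over_fibre M h (M x) \<le> h x"
  unfolding min_over_fibre_def by (rule INF_lower) simp

lemma arg_min_min_over_fibreI:
  fixes h :: "'a \<Rightarrow> ereal"
  assumes "is_arg_min (\<lambda>x. h x + ereal (q (M x))) (\<lambda>_. True) x"
  shows "is_arg_min (\<lambda>t. min_over_fibre M h t + ereal (q t)) (\<lambda>_. True) (M x)"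
  unfolding is_arg_min_True_iff
proof
  fix t
  \<comment> \<open>The penalty is constant on a fibre and finite, so it can be moved across before
    taking the infimum.\<close>
  have "h x + ereal (q (M x)) - ereal (q t) \<le> h v" if "M v = t" for v
    using assms that unfolding is_arg_min_True_iff by (auto simp: ereal_minus_le)
  then have "h x + ereal (q (M x)) - ereal (q t) \<le> min_over_fibre M h t"
    unfolding min_over_fibre_def by (intro INF_greatest) auto
  then have "h x + ereal (q (M x)) \<le> min_over_fibre M h t + ereal (q t)"
    by (simp add: ereal_minus_le)
  with add_right_mono[OF min_over_fibre_le]
  show "min_over_fibre M h (M x) + ereal (q (M x)) \<le> min_over_fibre M h t + ereal (q t)"
    by (rule order_trans)
qed

text \<open>Attainment is available only at finite values; properness makes the value at a minimizer
  finite.\<close>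

lemma arg_min_min_over_fibreD:
  fixes h :: "'a \<Rightarrow> ereal"
  assumes att: "min_attained M h" and proper: "proper_fun (min_over_fibre M h)"
    and t: "is_arg_min (\<lambda>t. min_over_fibre M h t + ereal (q t)) (\<lambda>_. True) t"
  shows "\<exists>x. M x = t \<and> is_arg_min (\<lambda>x. h x + ereal (q (M x))) (\<lambda>_. True) x"
proof -
  obtain x where x: "M x = t" "h x = min_over_fibre M h t"
    using att[unfolded min_attained_def, rule_format, OF finite_at_arg_min[OF proper t]]
    by metis
  have "h x + ereal (q (M x)) \<le> h v + ereal (q (M v))" for v
  proof -
    have "h x + ereal (q (M x)) \<le> min_over_fibre M h (M v) + ereal (q (M v))"
      using t x by (simp add: is_arg_min_True_iff)
    also have "\<dots> \<le> h v + ereal (q (M v))"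
      by (intro add_right_mono min_over_fibre_le)
    finally show ?thesis .
  qed
  with x show ?thesis by (auto simp: is_arg_min_True_iff)
qed

section \<open>Exchanging the update order\<close>

lemma affine_mapping_reflect:
  assumes "affine_mapping T"
  shows "T (2 *\<^sub>R r - s) = 2 *\<^sub>R T r - T s"
proof -
  \<comment> \<open>The point \<open>r\<close> is the midpoint of \<open>s\<close> and its
    reflection.\<close>
  have "(1 / 2) *\<^sub>R (2 *\<^sub>R r - s) + (1 / 2) *\<^sub>R s = r" by (simp add: scaleR_diff_right)
  then have "T r = (1 / 2) *\<^sub>R T (2 *\<^sub>R r - s) + (1 / 2) *\<^sub>R T s"
    using assms unfolding affine_mapping_def by metis
  then show ?thesis by (simp add: scaleR_add_right)
qed

text \<open>
  Shifting the right-hand side into one constraint map makes the two update orders literally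
  the same recursion with the blocks exchanged.
\<close>

lemma adm_x_first_shift:
  "adm_x_first f g A B b lam x y z \<longleftrightarrow> adm_x_first f g A (\<lambda>v. B v - b) 0 lam x y z"
  by (simp add: adm_x_first_def add_diff_eq)

lemma adm_y_first_shift:
  "adm_y_first f g A B b lam x y z \<longleftrightarrow> adm_y_first f g A (\<lambda>v. B v - b) 0 lam x y z"
  by (simp add: adm_y_first_def add_diff_eq)

lemma adm_y_first_swap:
  "adm_y_first f g P Q 0 lam x y z \<longleftrightarrow> adm_x_first g f Q P 0 lam y x z"
  by (simp add: adm_x_first_def adm_y_first_def add.commute)

text \<open>The formulas fix the new \<open>x\<close> and multiplier sequences; only the
  \<open>y\<close> iterates must be chosen, as lifts under \<open>Q\<close> of the points
  \<open>2 *\<^sub>R t (k + 1) - t k\<close>.\<close>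

lemma adm_x_first_imp_adm_y_first:
  fixes P :: "'a \<Rightarrow> 'c::{real_inner, complete_space}" and Q :: "'b \<Rightarrow> 'c"
    and f :: "'a \<Rightarrow> ereal" and g :: "'b \<Rightarrow> ereal"
  assumes lam: "lam > 0" and G_def: "G = min_over_fibre Q g"
    and G: "proper_closed_convex G" and att: "min_attained Q g"
    and aff: "affine_mapping (prox (\<lambda>t. ereal lam * G t))"
    and run: "adm_x_first f g P Q 0 lam x y z"
    and sub: "- z 0 \<in> subdifferential G (Q (y 0))"
  shows "\<exists>y'. adm_y_first f g P Q 0 lam (\<lambda>k. x (k + 1)) y'
    (\<lambda>k. z k + inverse lam *\<^sub>R (P (x (k + 1)) + Q (y k)))"
proof -
  \<comment> \<open>\<open>s k\<close> belongs to the iterate \<open>k + 1\<close>, since \<open>x 0\<close> is unused in this run.\<close>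
  define s where "s k = P (x (k + 1))" for k
  define t where "t k = Q (y k)" for k
  define z' where "z' k = z k + inverse lam *\<^sub>R (s k + t k)" for k
  define T where "T = prox (\<lambda>t. ereal lam * G t)"
  let ?min = "\<lambda>w. is_arg_min (\<lambda>t. G t + ereal (1 / (2 * lam) * (norm (t + w))\<^sup>2)) (\<lambda>_. True)"
  have zsuc: "z (k + 1) = z k + inverse lam *\<^sub>R (s k + t (k + 1))" for k
    using run by (simp add: adm_x_first_def s_def t_def)
  have lz: "lam *\<^sub>R z (k + 1) = lam *\<^sub>R z k + s k + t (k + 1)" for k
    unfolding zsuc using lam by (simp add: scaleR_add_right)
  have lz': "lam *\<^sub>R z' k = lam *\<^sub>R z k + s k + t k" for k
    using lam by (simp add: z'_def scaleR_add_right)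
  have min_t_Suc: "?min (s k + lam *\<^sub>R z k) (t (k + 1))" for k
  proof -
    have "is_arg_min (\<lambda>v. g v + ereal (1 / (2 * lam) * (norm (Q v + (s k + lam *\<^sub>R z k)))\<^sup>2))
        (\<lambda>_. True) (y (k + 1))"
      using run by (simp add: adm_x_first_def s_def algebra_simps)
    then show ?thesis
      unfolding G_def t_def by (rule arg_min_min_over_fibreI)
  qed
  have T_t: "T (t k - lam *\<^sub>R z k) = t k" for k
  proof -
    \<comment> \<open>A case split suffices: index 0 is the subgradient hypothesis, and at
      \<open>Suc j\<close> the multiplier update turns this offset into that of the preceding
      \<open>y\<close> update.\<close>
    have "?min (lam *\<^sub>R z k - t k) (t k)"
    proof (cases k)
      case 0
      then show ?thesis using subdifferential_imp_arg_min[OF sub lam] by (simp add: t_def)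
    next
      case (Suc j)
      then show ?thesis using min_t_Suc[of j] lz[of j] by (simp add: algebra_simps)
    qed
    from prox_eqI[OF G lam this] show ?thesis by (simp add: T_def)
  qed
  have "\<forall>k. \<exists>v. Q v = 2 *\<^sub>R t (k + 1) - t k \<and>
      is_arg_min (\<lambda>v. g v + ereal (1 / (2 * lam) * (norm (Q v + (s k + lam *\<^sub>R z' k)))\<^sup>2)) (\<lambda>_. True) v"
  proof
    fix k
    obtain p where p: "?min (s k + lam *\<^sub>R z' k) p"
      using quadratic_arg_min_exists[OF G _ sub, of "1 / (2 * lam)"] lam by auto
    \<comment> \<open>Here \<open>a\<close>, \<sigma>, \<tau>, \<rho> stand for
      \<open>lam *\<^sub>R z k\<close>, \<open>s k\<close>, \<open>t k\<close>,
      \<open>t (k + 1)\<close>.\<close>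
    have "- (\<sigma> + (a + \<sigma> + \<tau>)) = 2 *\<^sub>R (\<rho> - (a + \<sigma> + \<rho>)) - (\<tau> - a)"
      for a \<sigma> \<tau> \<rho> :: 'c by (simp add: algebra_simps scaleR_2)
    then have "- (s k + lam *\<^sub>R z' k)
        = 2 *\<^sub>R (t (k + 1) - lam *\<^sub>R z (k + 1)) - (t k - lam *\<^sub>R z k)"
      unfolding lz lz' .
    then have "T (- (s k + lam *\<^sub>R z' k)) = 2 *\<^sub>R t (k + 1) - t k"
      using affine_mapping_reflect[OF aff, folded T_def] T_t by simp
    with prox_eqI[OF G lam p] have "p = 2 *\<^sub>R t (k + 1) - t k" by (simp add: T_def)
    with p show "\<exists>v. Q v = 2 *\<^sub>R t (k + 1) - t k \<and> is_arg_min
        (\<lambda>v. g v + ereal (1 / (2 * lam) * (norm (Q v + (s k + lam *\<^sub>R z' k)))\<^sup>2)) (\<lambda>_. True) v"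
      using arg_min_min_over_fibreD[OF att, of "\<lambda>t. 1 / (2 * lam) * (norm (t + (s k + lam *\<^sub>R z' k)))\<^sup>2" p]
        G unfolding G_def proper_closed_convex_def by blast
  qed
  from choice[OF this] obtain v where Qv: "\<And>k. Q (v k) = 2 *\<^sub>R t (k + 1) - t k"
    and v: "\<And>k. is_arg_min (\<lambda>v. g v + ereal (1 / (2 * lam) * (norm (Q v + (s k + lam *\<^sub>R z' k)))\<^sup>2))
      (\<lambda>_. True) (v k)"
    by blast
  \<comment> \<open>Consequently the new \<open>x\<close> subproblem at step \<open>k\<close>
    coincides with the old one at step \<open>k + 1\<close>.\<close>
  have shift: "Q (v k) + lam *\<^sub>R z' k = t (k + 1) + lam *\<^sub>R z (k + 1)" for k
    unfolding Qv lz lz' by (simp add: scaleR_2)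
  \<comment> \<open>The lift \<open>v k\<close> is iterate \<open>k + 1\<close>; truncated
    subtraction gives index 0 an arbitrary value.\<close>
  have "adm_y_first f g P Q 0 lam (\<lambda>k. x (k + 1)) (\<lambda>k. v (k - 1)) z'"
    unfolding adm_y_first_def
  proof (intro allI conjI)
    fix k
    show "is_arg_min (\<lambda>v. g v + ereal (1 / (2 * lam) * (norm (P (x (k + 1)) + Q v - 0 + lam *\<^sub>R z' k))\<^sup>2))
        (\<lambda>_. True) (v (k + 1 - 1))"
      using v[of k] by (simp add: s_def algebra_simps)
    have "P u + Q (v k) + lam *\<^sub>R z' k = P u + Q (y (k + 1)) + lam *\<^sub>R z (k + 1)" for u
      using shift[of k] by (simp only: add.assoc t_def)
    moreover have "is_arg_min (\<lambda>u. f u + ereal (1 / (2 * lam) *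
        (norm (P u + Q (y (k + 1)) - 0 + lam *\<^sub>R z (k + 1)))\<^sup>2)) (\<lambda>_. True) (x (k + 1 + 1))"
      using run unfolding adm_x_first_def by blast
    ultimately show "is_arg_min (\<lambda>u. f u + ereal (1 / (2 * lam) *
          (norm (P u + Q (v (k + 1 - 1)) - 0 + lam *\<^sub>R z' k))\<^sup>2)) (\<lambda>_. True) (x (k + 1 + 1))"
      by (simp only: diff_zero add_diff_cancel_right')
    \<comment> \<open>These are the increments over \<open>z k\<close>, before scaling, of the two
      expressions for \<open>z' (k + 1)\<close>.\<close>
    have "(s k + t (k + 1)) + (s (k + 1) + t (k + 1)) = (s k + t k) + (s (k + 1) + Q (v k))"
      unfolding Qv by (simp add: scaleR_2)
    then have "z' (k + 1) = z' k + inverse lam *\<^sub>R (s (k + 1) + Q (v k))"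
      unfolding z'_def zsuc add.assoc[of "z k"] scaleR_add_right[symmetric] by simp
    then show "z' (k + 1) = z' k + inverse lam *\<^sub>R (P (x (k + 1 + 1)) + Q (v (k + 1 - 1)) - 0)"
      by (simp add: s_def)
  qed
  then show ?thesis unfolding z'_def s_def t_def by blast
qed

theorem theorem3:
  fixes A :: "'a::{real_inner, complete_space} \<Rightarrow> 'c::{real_inner, complete_space}"
    and B :: "'b::{real_inner, complete_space} \<Rightarrow> 'c"
    and b :: 'c
    and lam :: real
    and f :: "'a \<Rightarrow> ereal"
    and g :: "'b \<Rightarrow> ereal"
    and F G :: "'c \<Rightarrow> ereal"
  assumes "bounded_linear A" and "bounded_linear B" and "lam > 0"
    and "proper_closed_convex f" and "proper_closed_convex g"
    and F_def: "F = min_over_fibre A f"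
    and G_def: "G = min_over_fibre (\<lambda>y. B y - b) g"
    and "proper_closed_convex F" and "proper_closed_convex G"
    and "min_attained A f" and "min_attained (\<lambda>y. B y - b) g"
    and "\<exists>x y z. saddle_point f g A B b x y z"
  shows
    "(affine_mapping (prox (\<lambda>t. ereal lam * G t)) \<longrightarrow>
       (\<forall>x5 y5 z5. adm_x_first f g A B b lam x5 y5 z5 \<and>
          - z5 0 \<in> subdifferential G (B (y5 0) - b) \<longrightarrow>
          (\<exists>x1 y1 z1. adm_y_first f g A B b lam x1 y1 z1 \<and>
             x1 0 = x5 1 \<and>
             z1 0 = z5 0 + inverse lam *\<^sub>R (A (x5 1) + B (y5 0) - b) \<and>
             (\<forall>k. x1 k = x5 (k + 1) \<and>
                  z1 k = z5 k + inverse lam *\<^sub>R (A (x5 (k + 1)) + B (y5 k) - b)))))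
     \<and>
     (affine_mapping (prox (\<lambda>s. ereal lam * F s)) \<longrightarrow>
       (\<forall>x1 y1 z1. adm_y_first f g A B b lam x1 y1 z1 \<and>
          - z1 0 \<in> subdifferential F (A (x1 0)) \<longrightarrow>
          (\<exists>x5 y5 z5. adm_x_first f g A B b lam x5 y5 z5 \<and>
             y5 0 = y1 1 \<and>
             z5 0 = z1 0 + inverse lam *\<^sub>R (A (x1 0) + B (y1 1) - b) \<and>
             (\<forall>k. y5 k = y1 (k + 1) \<and>
                  z5 k = z1 k + inverse lam *\<^sub>R (A (x1 k) + B (y1 (k + 1)) - b)))))"
proof (intro conjI impI allI; elim conjE)
  fix x5 y5 z5
  assume aff: "affine_mapping (prox (\<lambda>t. ereal lam * G t))"
    and run: "adm_x_first f g A B b lam x5 y5 z5"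
    and sub: "- z5 0 \<in> subdifferential G (B (y5 0) - b)"
  obtain y' where "adm_y_first f g A (\<lambda>v. B v - b) 0 lam (\<lambda>k. x5 (k + 1)) y'
      (\<lambda>k. z5 k + inverse lam *\<^sub>R (A (x5 (k + 1)) + (B (y5 k) - b)))"
    using adm_x_first_imp_adm_y_first[OF \<open>lam > 0\<close> G_def \<open>proper_closed_convex G\<close>
        \<open>min_attained (\<lambda>y. B y - b) g\<close> aff] run[unfolded adm_x_first_shift[of _ _ _ B]] sub
    by blast
  then have "adm_y_first f g A B b lam (\<lambda>k. x5 (k + 1)) y'
      (\<lambda>k. z5 k + inverse lam *\<^sub>R (A (x5 (k + 1)) + B (y5 k) - b))"
    unfolding adm_y_first_shift[of _ _ _ B] add_diff_eq .
  then show "\<exists>x1 y1 z1. adm_y_first f g A B b lam x1 y1 z1 \<and> x1 0 = x5 1 \<and>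
      z1 0 = z5 0 + inverse lam *\<^sub>R (A (x5 1) + B (y5 0) - b) \<and>
      (\<forall>k. x1 k = x5 (k + 1) \<and> z1 k = z5 k + inverse lam *\<^sub>R (A (x5 (k + 1)) + B (y5 k) - b))"
    by (intro exI conjI) auto
next
  fix x1 y1 z1
  assume aff: "affine_mapping (prox (\<lambda>s. ereal lam * F s))"
    and run: "adm_y_first f g A B b lam x1 y1 z1"
    and sub: "- z1 0 \<in> subdifferential F (A (x1 0))"
  \<comment> \<open>Second claim: with the blocks exchanged, the given run updates its first block
    first, so the same lemma applies with \<open>F\<close> in place of \<open>G\<close>.\<close>
  have "adm_x_first g f (\<lambda>v. B v - b) A 0 lam y1 x1 z1"
    using run adm_y_first_shift adm_y_first_swap by blast
  then obtain x' where "adm_y_first g f (\<lambda>v. B v - b) A 0 lam (\<lambda>k. y1 (k + 1)) x'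
      (\<lambda>k. z1 k + inverse lam *\<^sub>R (B (y1 (k + 1)) - b + A (x1 k)))"
    using adm_x_first_imp_adm_y_first[OF \<open>lam > 0\<close> F_def \<open>proper_closed_convex F\<close>
        \<open>min_attained A f\<close> aff] sub
    by blast
  moreover have "B v - b + A u = A u + B v - b" for u v
    by simp
  ultimately have "adm_x_first f g A B b lam x' (\<lambda>k. y1 (k + 1))
      (\<lambda>k. z1 k + inverse lam *\<^sub>R (A (x1 k) + B (y1 (k + 1)) - b))"
    unfolding adm_x_first_shift[of _ _ _ B] adm_y_first_swap by simp
  then show "\<exists>x5 y5 z5. adm_x_first f g A B b lam x5 y5 z5 \<and> y5 0 = y1 1 \<and>
      z5 0 = z1 0 + inverse lam *\<^sub>R (A (x1 0) + B (y1 1) - b) \<and>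
      (\<forall>k. y5 k = y1 (k + 1) \<and> z5 k = z1 k + inverse lam *\<^sub>R (A (x1 k) + B (y1 (k + 1)) - b))"
    by (intro exI conjI) auto
qed

end
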